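(* Let $f,g,h:\mathbb{N}\to\mathbb{C}$ with $h(1)\ne 0$, such that $\sum_{k=1}^\infty\sum_{m=1}^\infty\frac{h(k)h^{-1\circ}(m)}{\xi(k)\xi(m)}g(kmn)$ is absolutely convergent for all $n\ge1$. If $$f(n)=\sum_{m=1}^\infty\frac{h(m)}{\xi(m)}g(mn)\quad\text{for all }n\ge1,$$ then $$g(n)=\sum_{m=1}^\infty\frac{h^{-1\circ}(m)}{\xi(m)}f(mn)\quad\text{for all }n\ge1.$$
   Context: Writing $n=\prod_p p^{\nu_p(n)}$, $\xi(n)=\prod_p\nu_p(n)!$. The binomial convolution is $(f\circ g)(n)=\sum_{d\mid n}\left(\prod_p\binom{\nu_p(n)}{\nu_p(d)}\right)f(d)g(n/d)$, with identity $\delta$ ($\delta(1)=1$, $\delta(n)=0$ for $n>1$); $h^{-1\circ}$ is the inverse of $h$ under $\circ$. *)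

theory Defs
  imports "HOL-Analysis.Analysis" "HOL-Computational_Algebra.Primes"
begin

text \<open>
  Arithmetical functions, i.e. functions on the positive integers, are represented by functions of
  type \<^typ>\<open>nat \<Rightarrow> complex\<close>; their value at \<^term>\<open>0 :: nat\<close> is irrelevant. The products over all
  primes are restricted to the prime factors of \<open>n\<close>: for every other prime \<open>p\<close> the exponents of
  \<open>p\<close> in \<open>n\<close> and in its divisors vanish, and the corresponding factor is 1.
\<close>

definition xi :: "nat \<Rightarrow> nat" where
  "xi n = (\<Prod>p\<in>prime_factors n. fact (multiplicity p n))"

definition binomial_conv :: "(nat \<Rightarrow> complex) \<Rightarrow> (nat \<Rightarrow> complex) \<Rightarrow> nat \<Rightarrow> complex" where
  "binomial_conv f g n =
     (\<Sum>d | d dvd n.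
        of_nat (\<Prod>p\<in>prime_factors n. multiplicity p n choose multiplicity p d) *
        f d * g (n div d))"

definition delta :: "nat \<Rightarrow> complex" where
  "delta n = (if n = 1 then 1 else 0)"

text \<open>
  The condition at 0 only normalises the irrelevant value, so that the inverse is unique whenever
  \<open>h 1 \<noteq> 0\<close>. One-sided inverses suffice since the convolution is commutative on the positive
  integers.
\<close>

definition binomial_inverse :: "(nat \<Rightarrow> complex) \<Rightarrow> nat \<Rightarrow> complex" where
  "binomial_inverse h =
     (THE u. u 0 = 0 \<and> (\<forall>n\<ge>1. binomial_conv h u n = delta n))"

end

theory Submission
  imports Defs
begin

text \<open>
  Since \<open>xi (k m) / (xi k * xi m)\<close> is the product of the binomial coefficients in the convolution,
  grouping the absolutely convergent double series by \<open>N = k m\<close> turns it into the series of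
  \<open>binomial_conv h (binomial_inverse h) N / xi N * g (N n)\<close>, of which only the term \<open>g n\<close> at \<open>N = 1\<close>
  survives. Summing over \<open>k\<close> first gives the series of \<open>binomial_inverse h m / xi m * f (m n)\<close>
  instead.
\<close>

lemma xi_pos: "xi n > 0"
  unfolding xi_def by (auto intro!: prod_pos)

text \<open>Primes of \<open>A\<close> outside \<open>n\<close> have exponent 0 and contribute 0! =
  1. This puts \<open>xi\<close> of a number and of its divisors over one common index set.\<close>

lemma xi_eq_prod_superset:
  assumes "finite A" "prime_factors n \<subseteq> A" "\<And>p. p \<in> A \<Longrightarrow> prime p"
  shows "xi n = (\<Prod>p\<in>A. fact (multiplicity p n))"
  unfolding xi_def using assms
  by (intro prod.mono_neutral_left) (auto simp: prime_factors_multiplicity)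

text \<open>Exponents add in n = d * (n div d), so at each prime this is the factorial formula a! =
  (a choose b) * b! * (a - b)!.\<close>

lemma xi_mult_binomial:
  assumes "n > 0" "d dvd n"
  shows "xi n = (\<Prod>p\<in>prime_factors n. multiplicity p n choose multiplicity p d) * (xi d * xi (n div d))"
proof -
  obtain e where n: "n = d * e" using assms by auto
  have nz: "d \<noteq> 0" "e \<noteq> 0" "n div d = e" using assms n by auto
  have "xi d = (\<Prod>p\<in>prime_factors n. fact (multiplicity p d))"
    using nz n by (intro xi_eq_prod_superset) (auto simp: prime_factors_product)
  moreover have "xi e = (\<Prod>p\<in>prime_factors n. fact (multiplicity p e))"
    using nz n by (intro xi_eq_prod_superset) (auto simp: prime_factors_product)
  moreover have "fact (multiplicity p n) = (multiplicity p n choose multiplicity p d) *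
      (fact (multiplicity p d) * fact (multiplicity p e))" if "p \<in> prime_factors n" for p
  proof -
    have "multiplicity p n = multiplicity p d + multiplicity p e"
      using that nz(1,2) unfolding n
      by (intro prime_elem_multiplicity_mult_distrib) (auto dest: in_prime_factors_imp_prime)
    then show ?thesis
      using binomial_fact_lemma[of "multiplicity p d" "multiplicity p n"] by (simp add: mult_ac)
  qed
  ultimately show ?thesis
    by (simp add: nz(3) xi_def[of n] flip: prod.distrib)
qed

text \<open>Division by \<open>xi\<close> carries the binomial convolution to the ordinary Dirichlet
  convolution.\<close>

lemma binomial_conv_eq_xi:
  assumes "n > 0"
  shows "binomial_conv f g n =
    of_nat (xi n) * (\<Sum>d | d dvd n. f d / of_nat (xi d) * (g (n div d) / of_nat (xi (n div d))))"
proof -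
  have "of_nat (\<Prod>p\<in>prime_factors n. multiplicity p n choose multiplicity p d) * f d * g (n div d) =
      of_nat (xi n) * (f d / of_nat (xi d) * (g (n div d) / of_nat (xi (n div d))))"
    if "d dvd n" for d
    using xi_pos[of d] xi_pos[of "n div d"]
    by (subst xi_mult_binomial[OF assms that]) (simp add: field_simps del: of_nat_prod)
  then show ?thesis
    unfolding binomial_conv_def sum_distrib_left by (intro sum.cong) auto
qed

text \<open>Isolates the only term that involves \<open>g n\<close>; the others use \<open>g\<close>
  at smaller arguments, so a convolution equation can be solved for \<open>g n\<close> when
  \<open>f 1\<close> is nonzero.\<close>

lemma binomial_conv_split:
  assumes "n > 0"
  shows "binomial_conv f g n = f 1 * g n +
    (\<Sum>d | d dvd n \<and> d \<noteq> 1.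
       of_nat (\<Prod>p\<in>prime_factors n. multiplicity p n choose multiplicity p d) * f d * g (n div d))"
proof -
  have "finite {d. d dvd n}" using assms by simp
  then show ?thesis
    unfolding binomial_conv_def
    by (subst sum.remove[of _ 1]) (auto intro!: sum.cong arg_cong2[of _ _ _ _ "(+)"])
qed

function binomial_inverse_rec :: "(nat \<Rightarrow> complex) \<Rightarrow> nat \<Rightarrow> complex" where
  "binomial_inverse_rec h n = (if n = 0 then 0 else
     (delta n - (\<Sum>d | d dvd n \<and> d \<noteq> 1.
        of_nat (\<Prod>p\<in>prime_factors n. multiplicity p n choose multiplicity p d) *
        h d * binomial_inverse_rec h (n div d))) / h 1)"
  by auto
termination
proof (relation "Wellfounded.measure snd")
  fix n d :: nat
  assume "n \<noteq> 0" "d \<in> {d. d dvd n \<and> d \<noteq> 1}"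
  then have "n div d < n" by (intro div_less_dividend) (auto intro: Suc_lessI dvd_pos_nat)
  then show "((h, n div d), h, n) \<in> Wellfounded.measure snd" for h :: "nat \<Rightarrow> complex" by simp
qed simp

declare binomial_inverse_rec.simps [simp del]

text \<open>The definite description is meaningful only after unique existence is shown: the
  recursion supplies a solution, and strong induction shows that any solution obeys the same
  recursion.\<close>

lemma binomial_conv_inverse:
  assumes h: "h 1 \<noteq> 0" and n: "n \<ge> 1"
  shows "binomial_conv h (binomial_inverse h) n = delta n"
proof -
  let ?P = "\<lambda>u. u 0 = 0 \<and> (\<forall>n\<ge>1. binomial_conv h u n = delta n)"
  have "\<exists>!u. ?P u"
  proof (rule ex1I)
    show "?P (binomial_inverse_rec h)"
    proof (intro conjI allI impI)
      show "binomial_inverse_rec h 0 = 0" by (simp add: binomial_inverse_rec.simps)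
      show "binomial_conv h (binomial_inverse_rec h) n = delta n" if "n \<ge> 1" for n
        using that h binomial_conv_split[of n h "binomial_inverse_rec h"]
          binomial_inverse_rec.simps[of h n]
        by (simp add: field_simps)
    qed
  next
    fix u assume u: "?P u"
    have "u n = binomial_inverse_rec h n" for n
    proof (induction n rule: less_induct)
      case (less n)
      show ?case
      proof (cases "n = 0")
        case True
        then show ?thesis using u by (simp add: binomial_inverse_rec.simps)
      next
        case False
        let ?S = "\<lambda>v. \<Sum>d | d dvd n \<and> d \<noteq> 1.
          of_nat (\<Prod>p\<in>prime_factors n. multiplicity p n choose multiplicity p d) * h d * v (n div d)"
        have "?S u = ?S (binomial_inverse_rec h)"
        proof (intro sum.cong refl arg_cong2[of _ _ _ _ "(*)"] less.IH)
          fix d assume "d \<in> {d. d dvd n \<and> d \<noteq> 1}"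
          then show "n div d < n"
            using False by (intro div_less_dividend) (auto intro: Suc_lessI dvd_pos_nat)
        qed
        moreover have "h 1 * u n + ?S u = delta n"
          using u False binomial_conv_split[of n h u] by simp
        ultimately show ?thesis
          using False h by (subst binomial_inverse_rec.simps) (simp add: field_simps)
      qed
    qed
    then show "u = binomial_inverse_rec h" by auto
  qed
  from theI'[OF this] n show ?thesis
    unfolding binomial_inverse_def[symmetric] by blast
qed

text \<open>The inverse map sends (k, m) to (k * m, k): a pair is determined by its product and its
  first factor.\<close>

lemma bij_betw_divisor_pairs:
  "bij_betw (\<lambda>(n, d). (d, n div d)) (SIGMA n:{1..}. {d. d dvd n}) ({1..} \<times> {1::nat..})"
  by (rule bij_betwI[where g = "\<lambda>(k, m). (k * m, k)"])
     (auto simp: Suc_le_eq dvd_pos_nat dvd_div_eq_0_iff elim!: dvdE)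

lemma has_sum_group_by_product:
  fixes F :: "nat \<times> nat \<Rightarrow> complex"
  assumes "(F has_sum s) ({1..} \<times> {1..})"
  shows "((\<lambda>n. \<Sum>d | d dvd n. F (d, n div d)) has_sum s) {1..}"
proof -
  have "((\<lambda>x. F (case x of (n, d) \<Rightarrow> (d, n div d))) has_sum s) (SIGMA n:{1..}. {d. d dvd n})"
    using assms has_sum_reindex_bij_betw[OF bij_betw_divisor_pairs] by blast
  moreover have "((\<lambda>d. F (case (n, d) of (n, d) \<Rightarrow> (d, n div d))) has_sum
      (\<Sum>d | d dvd n. F (d, n div d))) {d. d dvd n}" if "n \<in> {1..}" for n
    using that by (auto intro!: has_sum_finite)
  ultimately show ?thesis
    by (rule has_sum_SigmaD)
qed

lemma has_sum_atLeast_1_imp_sums: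
  assumes "(F has_sum s) {1..}"
  shows "(\<lambda>m. F (Suc m)) sums s"
proof -
  have "bij_betw Suc UNIV {1..}"
    by (rule bij_betwI[where g = "\<lambda>n. n - 1"]) auto
  from has_sum_reindex_bij_betw[OF this, of F s] assms show ?thesis
    by (auto intro: has_sum_imp_sums)
qed

theorem theorem7p4:
  fixes f g h :: "nat \<Rightarrow> complex"
  assumes "h 1 \<noteq> 0"
    and "\<And>n. n \<ge> 1 \<Longrightarrow>
      (\<lambda>(k, m). norm (h k * binomial_inverse h m / (of_nat (xi k) * of_nat (xi m)) * g (k * m * n)))
        summable_on ({1..} \<times> {1..})"
    and "\<And>n. n \<ge> 1 \<Longrightarrow>
      (\<lambda>m. h (Suc m) / of_nat (xi (Suc m)) * g (Suc m * n)) sums f n"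
  shows "\<forall>n\<ge>1.
      (\<lambda>m. binomial_inverse h (Suc m) / of_nat (xi (Suc m)) * f (Suc m * n)) sums g n"
proof (intro allI impI)
  fix n :: nat assume n: "n \<ge> 1"
  define u where "u = binomial_inverse h"
  define F where
    "F = (\<lambda>(k, m). h k * u m / (of_nat (xi k) * of_nat (xi m)) * g (k * m * n))"
  have abs: "(\<lambda>x. norm (F x)) summable_on ({1..} \<times> {1..})"
    using assms(2)[OF n] by (simp add: F_def u_def case_prod_unfold)
  then obtain s where s: "(F has_sum s) ({1..} \<times> {1..})"
    using abs_summable_summable summable_on_def by blast

  have grouped: "(\<Sum>d | d dvd N. F (d, N div d)) = (if N = 1 then g n else 0)" if "N \<in> {1..}" for N
  proof -
    \<comment> \<open>The factor \<open>g (k * m * n)\<close> depends only on the product k * m = N,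
      so it leaves the divisor sum.\<close>
    have "(\<Sum>d | d dvd N. F (d, N div d)) =
        (\<Sum>d | d dvd N. h d / of_nat (xi d) * (u (N div d) / of_nat (xi (N div d)))) * g (N * n)"
      unfolding sum_distrib_right by (intro sum.cong) (auto simp: F_def)
    also have "\<dots> = binomial_conv h u N / of_nat (xi N) * g (N * n)"
      using that xi_pos[of N] by (subst binomial_conv_eq_xi) auto
    also have "\<dots> = delta N / of_nat (xi N) * g (N * n)"
      using binomial_conv_inverse[of h, OF assms(1)] that by (simp add: u_def)
    also have "\<dots> = (if N = 1 then g n else 0)"
      by (simp add: delta_def xi_def)
    finally show ?thesis .
  qed
  have "((\<lambda>N. if N = 1 then g n else 0) has_sum s) {1::nat..}"
    by (rule has_sum_cong[THEN iffD1, OF grouped has_sum_group_by_product[OF s]])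
  moreover have "((\<lambda>N. if N = 1 then g n else 0) has_sum g n) {1::nat..}"
    by (rule has_sum_finite_neutralI[of "{1}"]) auto
  ultimately have "s = g n"
    by (rule has_sum_unique)

  \<comment> \<open>With \<open>m\<close> as the outer index, the inner sums over \<open>k\<close>
    can be matched with the series for \<open>f\<close>.\<close>
  have swapped: "((\<lambda>(m, k). F (k, m)) has_sum g n) ({1..} \<times> {1..})"
    using has_sum_swap[THEN iffD1, OF s] unfolding \<open>s = g n\<close> .

  have inner: "((\<lambda>k. F (k, m)) has_sum u m / of_nat (xi m) * f (m * n)) {1..}" if m: "m \<in> {1..}" for m
  proof -
    \<comment> \<open>The hypothesis on \<open>f\<close> gives only convergence in the order of the
      index. Unconditional summability of the row is inherited from the double sum, and uniqueness
      of limits then identifies its value \<open>t\<close>.\<close>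
    have "(\<lambda>k. F (k, m)) summable_on {1..}"
      using swapped m by (intro summable_on_SigmaD1[of "\<lambda>m k. F (k, m)" "{1..}" "\<lambda>_. {1..}"])
        (auto simp: summable_on_def)
    then obtain t where t: "((\<lambda>k. F (k, m)) has_sum t) {1..}"
      by (auto simp: summable_on_def)
    have "(\<lambda>k. F (Suc k, m)) sums t"
      using has_sum_atLeast_1_imp_sums[OF t] .
    moreover have "(\<lambda>k. F (Suc k, m)) sums (u m / of_nat (xi m) * f (m * n))"
      using sums_mult[OF assms(3)[of "m * n"], of "u m / of_nat (xi m)"] m n
      by (simp add: F_def mult_ac del: mult_Suc mult_Suc_right)
    ultimately show ?thesis
      using t sums_unique2 by blast
  qed
  have "((\<lambda>m. u m / of_nat (xi m) * f (m * n)) has_sum g n) {1..}"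
    by (rule has_sum_SigmaD[OF swapped]) (unfold case_prod_conv, rule inner)
  from has_sum_atLeast_1_imp_sums[OF this]
  show "(\<lambda>m. binomial_inverse h (Suc m) / of_nat (xi (Suc m)) * f (Suc m * n)) sums g n"
    by (simp add: u_def)
qed

end
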